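(* For every positive integer $h$, the average distance of the multiplicative circulant graph $\Gamma_{2^h}=MC(2^h)$ is $$\mu(\Gamma_{2^h})=\begin{cases}\dfrac{2^h(3h+1)-1}{9(2^h-1)} & \text{if } h \text{ is even},\\[2mm] \dfrac{2^h(3h+1)+1}{9(2^h-1)} & \text{if } h \text{ is odd}.\end{cases}$$
   Context: For integers $m>1$, $h>0$, $MC(m^h)$ is the graph with vertex set $\mathbb{Z}_{m^h}$ in which distinct vertices $x,y$ are adjacent iff $x-y\equiv \pm m^i \pmod{m^h}$ for some $i\in\{0,\ldots,h-1\}$. For a graph $\Gamma$ with $N$ vertices, the average distance is $\mu(\Gamma)=\frac{1}{N(N-1)}\sum_{v_i,v_j\in V(\Gamma)} d_\Gamma(v_i,v_j)$, the sum over all ordered pairs of vertices, where $d_\Gamma$ is shortest-path distance. *)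

theory Defs
  imports
    "Graph_Theory.Pair_Digraph"
    "Graph_Theory.Shortest_Path"
    "HOL-Number_Theory.Cong"
begin

text \<open>
  An undirected simple graph is represented as a symmetric loop-free digraph without parallel
  arcs (\<^locale>\<open>pair_graph\<close>); the ring of integers modulo \<open>m ^ h\<close> is represented by the
  residues \<open>{0..<m ^ h}\<close>.
\<close>

definition MC :: "nat \<Rightarrow> nat \<Rightarrow> int pair_pre_digraph" where
  "MC m h = \<lparr>
     pverts = {0..<int m ^ h},
     parcs = {(x, y). x \<in> {0..<int m ^ h} \<and> y \<in> {0..<int m ^ h} \<and> x \<noteq> y \<and>
       (\<exists>i<h. [x - y = int m ^ i] (mod int m ^ h) \<or> [x - y = - (int m ^ i)] (mod int m ^ h))} \<rparr>"

lemma pair_graph_MC: "pair_graph (MC m h)"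
proof
  have fin: "finite (pverts (MC m h) \<times> pverts (MC m h))"
    by (simp add: MC_def)
  show "finite (parcs (MC m h))"
    by (rule finite_subset[OF _ fin]) (auto simp: MC_def)
  have neg: "[y - x = - c] (mod n)" if "[x - y = c] (mod n)" for x y c n :: int
    using that cong_minus_minus_iff[of "x - y" c n] by simp
  have neg': "[y - x = c] (mod n)" if "[x - y = - c] (mod n)" for x y c n :: int
    using neg[OF that] by simp
  show "symmetric (with_proj (MC m h))"
    unfolding symmetric_def
    by (rule symI) (auto simp: MC_def dest: neg neg')
qed (auto simp: MC_def)

text \<open>
  The length of a shortest walk, obtained by giving every arc weight 1.  The value is \<open>\<infinity>\<close> if
  there is no walk.
\<close>

definition graph_distance :: "('a, 'b) pre_digraph \<Rightarrow> 'a \<Rightarrow> 'a \<Rightarrow> ereal" where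
  "graph_distance G u v = wf_digraph.\<mu> G (\<lambda>_. 1) u v"

definition average_distance :: "('a, 'b) pre_digraph \<Rightarrow> ereal" where
  "average_distance G =
     (\<Sum>(u, v) \<in> verts G \<times> verts G. graph_distance G u v)
       / ereal (real (card (verts G)) * (real (card (verts G)) - 1))"

end

theory Submission
  imports Defs
begin

text \<open>
  The distance from \<open>u\<close> to \<open>v\<close> in \<open>MC 2 h\<close> is the least number \<open>w\<^sub>h(u - v)\<close> of signed powers
  \<open>\<plusminus>2\<^sup>i\<close>, \<open>i < h\<close>, whose sum is \<open>u - v\<close> modulo \<open>2\<^sup>h\<close>. Two equal units can be merged into one
  term at the next level, so at most one unit is needed: \<open>w\<^sub>h\<^sub>+\<^sub>1(2y) = w\<^sub>h(y)\<close> and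
  \<open>w\<^sub>h\<^sub>+\<^sub>1(2y + 1) = 1 + min (w\<^sub>h(y)) (w\<^sub>h(y + 1))\<close>.
  Let \<open>S\<^sub>h\<close> be the sum of \<open>w\<^sub>h\<close> over a period and \<open>T\<^sub>h\<close> the sum of the minima of consecutive values.
  The recursion gives \<open>S\<^sub>h\<^sub>+\<^sub>1 = S\<^sub>h + 2\<^sup>h + T\<^sub>h\<close>, and since consecutive values differ by at most \<open>1\<close>,
  \<open>T\<^sub>h\<^sub>+\<^sub>1 = 2 S\<^sub>h\<close>. Solving \<open>S\<^sub>h\<^sub>+\<^sub>2 = S\<^sub>h\<^sub>+\<^sub>1 + 2 S\<^sub>h + 2\<^sup>h\<^sup>+\<^sup>1\<close> yields
  \<open>9 S\<^sub>h = 2\<^sup>h (3 h + 1) - (-1)\<^sup>h\<close>.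
\<close>

section \<open>Representing residues by signed powers of two\<close>

fun signed_weight :: "nat \<Rightarrow> int \<Rightarrow> nat" where
  "signed_weight 0 x = 0"
| "signed_weight (Suc h) x =
     (if even x then signed_weight h (x div 2)
      else Suc (min (signed_weight h (x div 2)) (signed_weight h (x div 2 + 1))))"

lemma signed_weight_double: "signed_weight (Suc h) (2 * y) = signed_weight h y"
  by simp

lemma signed_weight_double_plus1:
  "signed_weight (Suc h) (2 * y + 1) = Suc (min (signed_weight h y) (signed_weight h (y + 1)))"
  by simp

lemmas signed_weight_Suc = signed_weight_double signed_weight_double_plus1

declare signed_weight.simps(2) [simp del]

lemma signed_weight_0: "signed_weight h 0 = 0"
  by (induction h) (simp_all add: signed_weight.simps)

lemma signed_weight_add_period: "signed_weight h (x + k * 2 ^ h) = signed_weight h x"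
proof (induction h arbitrary: x)
  case (Suc h)
  have *: "(x + k * 2 ^ Suc h) div 2 = x div 2 + k * 2 ^ h"
    by (simp add: algebra_simps)
  have "signed_weight h (x div 2 + k * 2 ^ h + 1) = signed_weight h (x div 2 + 1)"
    using Suc[of "x div 2 + 1"] by (simp add: algebra_simps)
  then show ?case
    unfolding signed_weight.simps(2) * by (simp add: Suc)
qed simp

lemma signed_weight_cong:
  assumes "[x = y] (mod 2 ^ h)"
  shows "signed_weight h x = signed_weight h y"
proof -
  from assms obtain k where "x = y + k * 2 ^ h"
    by (metis cong_iff_lin cong_sym mult.commute)
  then show ?thesis
    by (simp add: signed_weight_add_period)
qed

text \<open>Serves as the case \<open>i = 0\<close> of \<open>signed_weight_add_power\<close> and
  later decides the minima in \<open>signed_weight_min_sum_Suc\<close>.\<close>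

lemma signed_weight_succ:
  "signed_weight h (x + 1) \<le> Suc (signed_weight h x) \<and>
   signed_weight h x \<le> Suc (signed_weight h (x + 1))"
proof (induction h arbitrary: x)
  case (Suc h)
  show ?case
  proof (cases "even x")
    case True
    then obtain y where "x = 2 * y" ..
    then show ?thesis
      using Suc[of y] by (auto simp: signed_weight_Suc)
  next
    case False
    then obtain y where x: "x = 2 * y + 1" ..
    then have "x + 1 = 2 * (y + 1)" by simp
    then show ?thesis
      using Suc[of y] x by (simp only: signed_weight_Suc) auto
  qed
qed simp

text \<open>Halving turns \<open>2 ^ Suc j\<close> into \<open>2 ^ j\<close> and keeps the parity of
  \<open>x\<close>, so the induction comes down to a unit step or to \<open>h = 0\<close>. The two
  inequalities serve arcs of either sign.\<close>

lemma signed_weight_add_power: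
  "signed_weight h (x + 2 ^ i) \<le> Suc (signed_weight h x) \<and>
   signed_weight h x \<le> Suc (signed_weight h (x + 2 ^ i))"
proof (induction h arbitrary: x i)
  case (Suc h)
  show ?case
  proof (cases i)
    case 0
    then show ?thesis using signed_weight_succ[of "Suc h" x] by simp
  next
    case (Suc j)
    show ?thesis
    proof (cases "even x")
      case True
      then obtain y where x: "x = 2 * y" ..
      then have "x + 2 ^ i = 2 * (y + 2 ^ j)" using Suc by simp
      then show ?thesis
        using Suc.IH[of y j] x by (simp only: signed_weight_Suc)
    next
      case False
      then obtain y where x: "x = 2 * y + 1" ..
      then have "x + 2 ^ i = 2 * (y + 2 ^ j) + 1" using Suc by simp
      moreover have "y + 2 ^ j + 1 = (y + 1) + 2 ^ j" by simp
      ultimately show ?thesis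
        using Suc.IH[of y j] Suc.IH[of "y + 1" j] x by (simp only: signed_weight_Suc) auto
    qed
  qed
qed simp

lemma dvd_of_signed_weight_eq_0: "signed_weight h x = 0 \<Longrightarrow> 2 ^ h dvd x"
proof (induction h arbitrary: x)
  case (Suc h)
  from Suc.prems have "even x"
    by (auto simp: signed_weight.simps split: if_splits)
  then obtain y where "x = 2 * y" ..
  with Suc show ?case by (simp add: signed_weight_Suc)
qed simp

text \<open>For even \<open>x\<close> a descending step of the half is doubled. For odd
  \<open>x\<close> both unit neighbours are even, and their halves are the two candidates of the
  minimum in the recursion.\<close>

lemma signed_weight_descent:
  assumes "signed_weight h x = Suc n"
  shows "\<exists>i<h. signed_weight h (x + 2 ^ i) = n \<or> signed_weight h (x - 2 ^ i) = n"
  using assms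
proof (induction h arbitrary: x)
  case (Suc h)
  show ?case
  proof (cases "even x")
    case True
    then obtain y where x: "x = 2 * y" ..
    with Suc obtain i where i: "i < h"
      "signed_weight h (y + 2 ^ i) = n \<or> signed_weight h (y - 2 ^ i) = n"
      by (auto simp: signed_weight_Suc)
    have "x + 2 ^ Suc i = 2 * (y + 2 ^ i)" "x - 2 ^ Suc i = 2 * (y - 2 ^ i)"
      using x by simp_all
    with i show ?thesis
      by (metis Suc_less_eq signed_weight_double)
  next
    case False
    then obtain y where x: "x = 2 * y + 1" ..
    have *: "x + 2 ^ 0 = 2 * (y + 1)" "x - 2 ^ 0 = 2 * y"
      using x by simp_all
    from Suc.prems have "min (signed_weight h y) (signed_weight h (y + 1)) = n"
      by (simp add: x signed_weight_Suc)
    then have "signed_weight (Suc h) (x + 2 ^ 0) = n \<or> signed_weight (Suc h) (x - 2 ^ 0) = n"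
      unfolding * signed_weight_double by linarith
    then show ?thesis by blast
  qed
qed simp

section \<open>Weights as distances in \<open>MC 2 h\<close>\<close>

lemma signed_weight_le_of_arc:
  assumes "(x, y) \<in> parcs (MC 2 h)"
  shows "signed_weight h (x - v) \<le> Suc (signed_weight h (y - v))"
proof -
  from assms obtain i where
    "[x - y = 2 ^ i] (mod 2 ^ h) \<or> [x - y = - (2 ^ i)] (mod 2 ^ h)"
    by (auto simp: MC_def)
  then show ?thesis
  proof
    assume "[x - y = 2 ^ i] (mod 2 ^ h)"
    then have "[(x - y) + (y - v) = 2 ^ i + (y - v)] (mod 2 ^ h)"
      by (rule cong_add) simp
    then have "signed_weight h (x - v) = signed_weight h (y - v + 2 ^ i)"
      by (intro signed_weight_cong) (simp add: add.commute)
    then show ?thesis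
      using signed_weight_add_power[of h "y - v" i] by simp
  next
    assume "[x - y = - (2 ^ i)] (mod 2 ^ h)"
    then have "[(x - y) + (y - v + 2 ^ i) = - (2 ^ i) + (y - v + 2 ^ i)] (mod 2 ^ h)"
      by (rule cong_add) simp
    then have "signed_weight h (x - v + 2 ^ i) = signed_weight h (y - v)"
      by (intro signed_weight_cong) (simp add: algebra_simps)
    then show ?thesis
      using signed_weight_add_power[of h "x - v" i] by simp
  qed
qed

lemma wf_digraph_MC: "wf_digraph (with_proj (MC m h))"
  using pair_graph_MC[of m h]
  by (simp add: wf_digraph_wp_iff pair_graph_def pair_digraph_def pair_fin_digraph_def)

text \<open>Upper bound on the distance: following \<open>signed_weight_descent\<close> loses one
  unit of weight per arc, and weight 0 forces equality of reduced residues.\<close>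

lemma exists_awalk_MC:
  assumes "u \<in> pverts (MC 2 h)" "v \<in> pverts (MC 2 h)" "signed_weight h (u - v) = n"
  shows "\<exists>p. pre_digraph.awalk (with_proj (MC 2 h)) u p v \<and> length p = n"
  using assms(1,3)
proof (induction n arbitrary: u)
  case 0
  then have "[u = v] (mod 2 ^ h)"
    by (simp add: cong_iff_dvd_diff dvd_of_signed_weight_eq_0)
  then have "u = v"
    using 0 assms(2) by (auto simp: MC_def cong_def)
  then have "pre_digraph.awalk (with_proj (MC 2 h)) u [] v"
    using 0 by (simp add: pre_digraph.awalk_def pre_digraph.cas.simps)
  then show ?case by force
next
  case (Suc n)
  from signed_weight_descent[OF Suc.prems(2)] obtain i :: nat and c :: int
    where i: "i < h" and c: "c = 2 ^ i \<or> c = - (2 ^ i)"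
      and n: "signed_weight h (u - v + c) = n"
    by (metis diff_conv_add_uminus)
  define u' where "u' = (u + c) mod 2 ^ h"
  have u'_cong: "[u' = u + c] (mod 2 ^ h)"
    by (simp add: u'_def cong_def)
  then have "[u' - v = u + c - v] (mod 2 ^ h)"
    by (intro cong_diff) simp_all
  then have weight: "signed_weight h (u' - v) = n"
    using n signed_weight_cong by (metis add_diff_eq diff_add_eq add.commute)
  have u': "u' \<in> pverts (MC 2 h)"
    by (simp add: MC_def u'_def)
  from Suc.IH[OF u' weight] obtain p where
    p: "pre_digraph.awalk (with_proj (MC 2 h)) u' p v" "length p = n" by blast
  \<comment> \<open>Arcs join distinct vertices; the weights \<open>Suc n\<close> and
    \<open>n\<close> tell the two ends apart.\<close>
  have "u \<noteq> u'" using weight Suc.prems(2) by auto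
  moreover have "[u - u' = - c] (mod 2 ^ h)"
    using cong_diff[OF cong_refl[of u] u'_cong] by simp
  ultimately have "(u, u') \<in> parcs (MC 2 h)"
    using Suc.prems(1) u' i c by (auto simp: MC_def)
  then have "pre_digraph.awalk (with_proj (MC 2 h)) u ((u, u') # p) v"
    using p Suc.prems(1) by (simp add: pre_digraph.awalk_def pre_digraph.cas.simps)
  then show ?case using p(2) by force
qed

text \<open>Lower bound on the distance: each arc reduces the weight by at most one.\<close>

lemma signed_weight_le_length_awalk:
  assumes "pre_digraph.awalk (with_proj (MC 2 h)) u p v"
  shows "signed_weight h (u - v) \<le> length p"
  using assms
proof (induction p arbitrary: u)
  case Nil
  then show ?case by (simp add: pre_digraph.awalk_def pre_digraph.cas.simps signed_weight_0)
next
  case (Cons e p)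
  interpret wf_digraph "with_proj (MC 2 h)" by (rule wf_digraph_MC)
  from Cons.prems obtain u' where e: "e = (u, u')" "(u, u') \<in> parcs (MC 2 h)" "awalk u' p v"
    by (cases e) (auto simp: awalk_Cons_iff)
  show ?case
    using signed_weight_le_of_arc[OF e(2), of v] Cons.IH[OF e(3)] by simp
qed

lemma graph_distance_MC:
  assumes "u \<in> pverts (MC 2 h)" "v \<in> pverts (MC 2 h)"
  shows "graph_distance (with_proj (MC 2 h)) u v = ereal (real (signed_weight h (u - v)))"
proof -
  interpret wf_digraph "with_proj (MC 2 h)" by (rule wf_digraph_MC)
  have cost: "awalk_cost (\<lambda>_. 1) p = real (length p)" for p :: "(int \<times> int) list"
    by (induction p) simp_all
  obtain p where p: "awalk u p v" "length p = signed_weight h (u - v)"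
    using exists_awalk_MC[OF assms refl] by blast
  show ?thesis
    unfolding graph_distance_def \<mu>_def cost
  proof (rule antisym)
    show "(INF p\<in>{p. awalk u p v}. ereal (real (length p))) \<le> ereal (real (signed_weight h (u - v)))"
      using p by (auto intro: INF_lower2)
    show "ereal (real (signed_weight h (u - v))) \<le> (INF p\<in>{p. awalk u p v}. ereal (real (length p)))"
      by (auto intro!: INF_greatest dest: signed_weight_le_length_awalk)
  qed
qed

section \<open>Sums over a period and their recursion\<close>

lemma sum_shift_mod:
  fixes g :: "int \<Rightarrow> 'a :: comm_monoid_add" and n c :: int
  assumes "n > 0" and g: "\<And>x y. [x = y] (mod n) \<Longrightarrow> g x = g y"
  shows "(\<Sum>x\<in>{0..<n}. g (x + c)) = (\<Sum>x\<in>{0..<n}. g x)"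
  using assms(1)
  by (intro sum.reindex_bij_witness[where i = "\<lambda>x. (x - c) mod n" and j = "\<lambda>x. (x + c) mod n"])
    (auto simp: mod_diff_left_eq mod_add_left_eq intro!: g simp: cong_def)

definition signed_weight_sum :: "nat \<Rightarrow> nat" where
  "signed_weight_sum h = (\<Sum>x\<in>{0..<2 ^ h}. signed_weight h x)"

definition signed_weight_min_sum :: "nat \<Rightarrow> nat" where
  "signed_weight_min_sum h =
     (\<Sum>x\<in>{0..<2 ^ h}. min (signed_weight h x) (signed_weight h (x + 1)))"

lemma sum_double_range:
  fixes g :: "int \<Rightarrow> 'a :: comm_monoid_add" and n :: int
  shows "(\<Sum>x\<in>{0..<2 * n}. g x) = (\<Sum>x\<in>{0..<n}. g (2 * x) + g (2 * x + 1))"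
proof -
  have split: "{0..<2 * n} = (\<lambda>x. 2 * x) ` {0..<n} \<union> (\<lambda>x. 2 * x + 1) ` {0..<n}"
  proof (intro equalityI subsetI)
    fix x assume "x \<in> {0..<2 * n}"
    moreover have "x = 2 * (x div 2) \<or> x = 2 * (x div 2) + 1" by presburger
    ultimately show "x \<in> (\<lambda>x. 2 * x) ` {0..<n} \<union> (\<lambda>x. 2 * x + 1) ` {0..<n}"
      by (elim disjE) (auto intro!: image_eqI[where x = "x div 2"])
  qed auto
  have disjoint: "(\<lambda>x. 2 * x) ` {0..<n} \<inter> (\<lambda>x. 2 * x + 1) ` {0..<n} = {}"
    by auto presburger
  show ?thesis
    unfolding split
    by (subst sum.union_disjoint) (simp_all add: disjoint sum.reindex inj_on_def sum.distrib)
qed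

lemma signed_weight_sum_Suc:
  "signed_weight_sum (Suc h) = signed_weight_sum h + 2 ^ h + signed_weight_min_sum h"
  unfolding signed_weight_sum_def signed_weight_min_sum_def power_Suc sum_double_range
    signed_weight_Suc
  by (simp add: sum.distrib sum_Suc nat_power_eq)

text \<open>By \<open>signed_weight_succ\<close> an odd number weighs at least as much as either
  even neighbour. Hence the even member of each consecutive pair attains the minimum, and every even
  number is counted twice.\<close>

lemma signed_weight_min_sum_Suc: "signed_weight_min_sum (Suc h) = 2 * signed_weight_sum h"
proof -
  have even: "min (signed_weight (Suc h) (2 * x)) (signed_weight (Suc h) (2 * x + 1))
      = signed_weight h x" for x
    using signed_weight_succ[of h x] by (auto simp: signed_weight_Suc)
  have odd: "min (signed_weight (Suc h) (2 * x + 1)) (signed_weight (Suc h) (2 * x + 1 + 1))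
      = signed_weight h (x + 1)" for x
  proof -
    have "2 * x + 1 + 1 = 2 * (x + 1)" by simp
    then show ?thesis
      using signed_weight_succ[of h x] by (simp only: signed_weight_Suc) auto
  qed
  have "(\<Sum>x\<in>{0..<2 ^ h}. signed_weight h (x + 1)) = signed_weight_sum h"
    unfolding signed_weight_sum_def
    by (rule sum_shift_mod) (auto intro: signed_weight_cong)
  then show ?thesis
    unfolding signed_weight_min_sum_def power_Suc sum_double_range even odd
    by (simp add: sum.distrib signed_weight_sum_def)
qed

text \<open>The characteristic roots of the second-order recurrence are 2 and -1; the forcing term
  \<open>2 ^ (h + 1)\<close> is resonant with the root 2, which produces the term
  \<open>h * 2 ^ h\<close>.\<close>

lemma signed_weight_sum_closed_form:
  "9 * real (signed_weight_sum h) = 2 ^ h * (3 * real h + 1) - (- 1) ^ h"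
proof (induction h rule: induct_nat_012)
  case (ge2 h)
  then show ?case
    by (simp add: signed_weight_sum_Suc[of "Suc h"] signed_weight_min_sum_Suc algebra_simps)
qed (simp_all add: signed_weight_sum_Suc, simp_all add: signed_weight_sum_def signed_weight_min_sum_def)

section \<open>The average distance\<close>

lemma sum_graph_distance_MC:
  "(\<Sum>(u, v)\<in>verts (with_proj (MC 2 h)) \<times> verts (with_proj (MC 2 h)).
      graph_distance (with_proj (MC 2 h)) u v) = ereal (2 ^ h * real (signed_weight_sum h))"
proof -
  let ?V = "{0..<2 ^ h :: int}"
  have V: "pverts (MC 2 h) = ?V" by (simp add: MC_def)
  \<comment> \<open>For a fixed target \<open>v\<close> the differences run once through all
    residues, so every target contributes the same sum.\<close>
  have row: "(\<Sum>u\<in>?V. signed_weight h (u - v)) = signed_weight_sum h" for v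
    unfolding signed_weight_sum_def diff_conv_add_uminus
    by (rule sum_shift_mod) (auto intro: signed_weight_cong)
  have "(\<Sum>(u, v)\<in>?V \<times> ?V. graph_distance (with_proj (MC 2 h)) u v)
      = (\<Sum>(u, v)\<in>?V \<times> ?V. ereal (real (signed_weight h (u - v))))"
    by (intro sum.cong) (auto simp: graph_distance_MC V)
  also have "\<dots> = ereal (real (\<Sum>(u, v)\<in>?V \<times> ?V. signed_weight h (u - v)))"
    by (simp add: case_prod_unfold)
  also have "(\<Sum>(u, v)\<in>?V \<times> ?V. signed_weight h (u - v))
      = (\<Sum>v\<in>?V. \<Sum>u\<in>?V. signed_weight h (u - v))"
    by (subst sum.swap) (simp add: sum.cartesian_product)
  also have "\<dots> = 2 ^ h * signed_weight_sum h"
    by (simp add: row nat_power_eq)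
  finally show ?thesis by (simp add: V)
qed

theorem theorem3p25:
  fixes h :: nat
  assumes "h > 0"
  shows "average_distance (with_proj (MC 2 h)) =
    ereal (if even h
      then (2 ^ h * (3 * real h + 1) - 1) / (9 * (2 ^ h - 1))
      else (2 ^ h * (3 * real h + 1) + 1) / (9 * (2 ^ h - 1)))"
proof -
  have card: "real (card (verts (with_proj (MC 2 h)))) = 2 ^ h"
    by (simp add: MC_def nat_power_eq)
  \<comment> \<open>Keeps the denominator \<open>2 ^ h * (2 ^ h - 1)\<close> nonzero, so that the
    factor \<open>2 ^ h\<close> cancels.\<close>
  have "(1 :: real) < 2 ^ h"
    using assms by simp
  then have "average_distance (with_proj (MC 2 h))
      = ereal (real (signed_weight_sum h) / (2 ^ h - 1))"
    unfolding average_distance_def card sum_graph_distance_MC by simp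
  also have "real (signed_weight_sum h) / (2 ^ h - 1)
      = (9 * real (signed_weight_sum h)) / (9 * (2 ^ h - 1))"
    by (rule mult_divide_mult_cancel_left[symmetric]) simp
  finally show ?thesis
    unfolding signed_weight_sum_closed_form by simp
qed

end
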